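(* Let $M_1$ be the Turing machine with states $A,B,C$ and symbols $b,0,1,2$ defined in the context. The $3x+1$ conjecture is true if and only if, for every positive integer $x=\sum_{i=0}^k x_i3^i$, written in base 3 as $x_k\ldots x_0$, there exists an integer $n\ge 0$ such that, on input $x_k\ldots x_0$ (that is, started in the initial configuration ${}^\omega b(Ax_k)x_{k-1}\ldots x_0b^\omega$), the Turing machine $M_1$ eventually reaches the configuration ${}^\omega b\,0^n(A1)\,b^\omega$.
   Context: The $3x+1$ function $T$ on positive integers is $T(x)=x/2$ if $x$ is even and $T(x)=(3x+1)/2$ if $x$ is odd. The $3x+1$ conjecture is the assertion that, when $T$ is iterated from any positive integer, the loop $2\mapsto 1\mapsto 2$ is always reached (i.e. for every positive integer $m$ some iterate $T^j(m)$, $j\ge 0$, lies in $\{1,2\}$; equivalently some iterate equals $1$). Turing machines have one tape, infinite on both sides, made of cells containing symbols, one read/write head, a set $Q$ of states, a set $\Sigma$ of symbols containing a blank symbol $b$, and a next move function $\delta$. If $\delta(p,a)=(a',D,q)$ then the machine, reading symbol $a$ in state $p$, replaces $a$ by $a'$, moves one cell in direction $D\in\{L,R\}$ ($L$ = left, $R$ = right), and enters state $q$. The notation ${}^\omega b\,u(pa)v\,b^\omega$, with $u,v$ words over $\Sigma$, $a\in\Sigma$ and $p\in Q$, denotes the configuration in which the word $uav$ is written on the tape between two infinite strings of blanks, and the machine is in state $p$ with the head on the displayed symbol $a$. Configurations are considered up to translation of the tape. Base 3 representations are the usual ones, with $x_i\in\{0,1,2\}$, $x_k\neq 0$, most significant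 digit on the left. The machine $M_1$ has $Q=\{A,B,C\}$, $\Sigma=\{b,0,1,2\}$ (blank $b$), and the following transitions, where "$a'Dq$" in row $p$ and column $a$ means $\delta(p,a)=(a',D,q)$: Row $A$: on $b$: $bLC$; on $0$: $0RA$; on $1$: $0RB$; on $2$: $1RA$. Row $B$: on $b$: $2LC$; on $0$: $1RB$; on $1$: $2RA$; on $2$: $2RB$. Row $C$: on $b$: $bRA$; on $0$: $0LC$; on $1$: $1LC$; on $2$: $2LC$. The machine $M_1$ never halts (it has no transition to a halting state). *)

theory Defs
  imports Main
begin

definition T :: "nat \<Rightarrow> nat" where
  "T x = (if even x then x div 2 else (3 * x + 1) div 2)"

definition collatz_conjecture :: bool where
  "collatz_conjecture \<longleftrightarrow> (\<forall>m>0. \<exists>j. (T ^^ j) m \<in> {1, 2})"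

datatype direction = MoveL | MoveR

type_synonym ('q, 's) next_move = "'q \<Rightarrow> 's \<Rightarrow> 's \<times> direction \<times> 'q"

datatype ('q, 's) config = Config (state: 'q) (head: int) (tape: "int \<Rightarrow> 's")

fun offset :: "direction \<Rightarrow> int" where
  "offset MoveL = -1"
| "offset MoveR = 1"

definition tm_step :: "('q, 's) next_move \<Rightarrow> ('q, 's) config \<Rightarrow> ('q, 's) config" where
  "tm_step \<delta> c =
     (case \<delta> (state c) (tape c (head c)) of
        (a', D, q) \<Rightarrow> Config q (head c + offset D) ((tape c)(head c := a')))"

definition translate :: "int \<Rightarrow> ('q, 's) config \<Rightarrow> ('q, 's) config" where
  "translate s c = Config (state c) (head c + s) (\<lambda>i. tape c (i - s))"

(* Configurations are identified up to translation of the tape. *)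
definition same_config :: "('q, 's) config \<Rightarrow> ('q, 's) config \<Rightarrow> bool" where
  "same_config c c' \<longleftrightarrow> (\<exists>s. c' = translate s c)"

definition reaches :: "('q, 's) next_move \<Rightarrow> ('q, 's) config \<Rightarrow> ('q, 's) config \<Rightarrow> bool" where
  "reaches \<delta> c c' \<longleftrightarrow> (\<exists>t. same_config ((tm_step \<delta> ^^ t) c) c')"

(* The configuration with the word u a v written between two infinite strings of the
   blank symbol b, in state p, with the head on the displayed symbol a. The choice to put
   the first symbol of the word in cell 0 is immaterial, by same_config. *)
definition displayed_config ::
    "'s \<Rightarrow> 's list \<Rightarrow> 'q \<Rightarrow> 's \<Rightarrow> 's list \<Rightarrow> ('q, 's) config" where
  "displayed_config b u p a v =
     (let w = u @ a # v in
        Config p (int (length u))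
          (\<lambda>i. if 0 \<le> i \<and> i < int (length w) then w ! nat i else b))"

datatype m1_state = QA | QB | QC

datatype m1_symbol = Blank | D0 | D1 | D2

fun M1 :: "(m1_state, m1_symbol) next_move" where
  "M1 QA Blank = (Blank, MoveL, QC)"
| "M1 QA D0 = (D0, MoveR, QA)"
| "M1 QA D1 = (D0, MoveR, QB)"
| "M1 QA D2 = (D1, MoveR, QA)"
| "M1 QB Blank = (D2, MoveL, QC)"
| "M1 QB D0 = (D1, MoveR, QB)"
| "M1 QB D1 = (D2, MoveR, QA)"
| "M1 QB D2 = (D2, MoveR, QB)"
| "M1 QC Blank = (Blank, MoveR, QA)"
| "M1 QC D0 = (D0, MoveL, QC)"
| "M1 QC D1 = (D1, MoveL, QC)"
| "M1 QC D2 = (D2, MoveL, QC)"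

definition base3_digits :: "nat \<Rightarrow> nat \<Rightarrow> (nat \<Rightarrow> nat) \<Rightarrow> bool" where
  "base3_digits x k d \<longleftrightarrow>
     (\<forall>i\<le>k. d i \<in> {0, 1, 2}) \<and> d k \<noteq> 0 \<and> x = (\<Sum>i=0..k. d i * 3 ^ i)"

(* Only applied to 0, 1, 2. *)
definition digit_symbol :: "nat \<Rightarrow> m1_symbol" where
  "digit_symbol n = (if n = 0 then D0 else if n = 1 then D1 else D2)"

(* The tape carries the most significant digit d k leftmost, with the head on it. *)
definition input_config :: "nat \<Rightarrow> (nat \<Rightarrow> nat) \<Rightarrow> (m1_state, m1_symbol) config" where
  "input_config k d =
     displayed_config Blank [] QA (digit_symbol (d k))
       (map (\<lambda>i. digit_symbol (d i)) (rev [0..<k]))"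

end

theory Submission
  imports Defs "HOL-Library.More_List"
begin

text \<open>
  \<open>M1\<close> computes \<open>T\<close> by long division. Read from its most significant digit, a number is halved
  digit by digit, and the remainder carried from one digit to the next is \<open>0\<close> in state \<open>QA\<close>
  and \<open>1\<close> in state \<open>QB\<close>: the six transitions on digits are the solutions of
  \<open>3 * carry + digit = 2 * digit' + carry'\<close> (\<open>M1_divides\<close>). At the right end the tape
  holds \<open>x div 2\<close> and the state knows the parity of \<open>x\<close>. If \<open>x\<close> is even, then the tape already
  holds \<open>T x\<close>; if \<open>x\<close> is odd, then appending a digit \<open>2\<close> gives \<open>3 * (x div 2) + 2 = T x\<close>
  (\<open>turn\<close>). State \<open>QC\<close> carries the head back to the left end, and the next division starts.

  If the orbit of \<open>x\<close> arrives at \<open>1\<close>, then some sweep starts on a word for \<open>1\<close>. Such a word is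
  \<open>0 \<dots> 0 1\<close>; the zeros are there because a sweep keeps all digits, also those that have become
  leading zeros. In state \<open>QA\<close> the head passes over the zeros, leaving them unchanged, and arrives
  at the displayed configuration.

  Conversely, one attaches a number to every configuration, also in the middle of a sweep:
  the number under division in states \<open>QA\<close> and \<open>QB\<close>, the number on the tape in state \<open>QC\<close>
  (\<open>represents\<close>). A step either keeps this number or, at the right end, applies \<open>T\<close> to it, so
  that it stays in the orbit of the input. The displayed configuration represents \<open>1\<close>, and
  hence can be reached only if \<open>1\<close> is in the orbit.
\<close>

section \<open>Configurations seen from the head\<close>

text \<open>
  The tape is split at the head, in cell \<open>s\<close>: \<open>L\<close> lists the cells to the left of the head from
  right to left, and \<open>R\<close> starts with the scanned cell. All cells beyond the lists are blank, so
  a blank at the far end of a list may be dropped.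
\<close>
definition split_config :: "'s \<Rightarrow> int \<Rightarrow> 'q \<Rightarrow> 's list \<Rightarrow> 's list \<Rightarrow> ('q, 's) config" where
  "split_config b s p L R =
     Config p s (\<lambda>i. if i < s then nth_default b L (nat (s - 1 - i))
                     else nth_default b R (nat (i - s)))"

lemma split_config_blank_left: "split_config b s p [b] R = split_config b s p [] R"
  using nth_default_snoc_default[of b "[]"] unfolding split_config_def append_Nil by (simp only:)

lemma split_config_blank_right: "split_config b s p L (R @ [b]) = split_config b s p L R"
  unfolding split_config_def nth_default_snoc_default ..

lemma tm_step_right:
  assumes "\<delta> p a = (a', MoveR, q)"
  shows "tm_step \<delta> (split_config b s p L (a # R)) = split_config b (s + 1) q (a' # L) R"
proof -
  have "((\<lambda>i. if i < s then nth_default b L (nat (s - 1 - i))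
              else nth_default b (a # R) (nat (i - s)))(s := a')) i =
        (if i < s + 1 then nth_default b (a' # L) (nat (s + 1 - 1 - i))
         else nth_default b R (nat (i - (s + 1))))" for i
  proof -
    consider "i < s" | "i = s" | "i > s" by linarith
    then show ?thesis
    proof cases
      case 1
      then have "nat (s - i) = Suc (nat (s - 1 - i))" by linarith
      with 1 show ?thesis by simp
    next
      case 3
      then have "nat (i - s) = Suc (nat (i - (s + 1)))" by linarith
      with 3 show ?thesis by simp
    qed simp
  qed
  then show ?thesis
    using assms by (simp add: split_config_def tm_step_def fun_eq_iff)
qed

lemma tm_step_left:
  assumes "\<delta> p a = (a', MoveL, q)"
  shows "tm_step \<delta> (split_config b s p (l # L) (a # R)) = split_config b (s - 1) q L (l # a' # R)"
proof -
  have "((\<lambda>i. if i < s then nth_default b (l # L) (nat (s - 1 - i))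
              else nth_default b (a # R) (nat (i - s)))(s := a')) i =
        (if i < s - 1 then nth_default b L (nat (s - 1 - 1 - i))
         else nth_default b (l # a' # R) (nat (i - (s - 1))))" for i
  proof -
    consider "i < s - 1" | "i = s - 1" | "i = s" | "i > s" by linarith
    then show ?thesis
    proof cases
      case 1
      then have "nat (s - 1 - i) = Suc (nat (s - 1 - 1 - i))" by linarith
      with 1 show ?thesis by simp
    next
      case 4
      then have "nat (i - s) = Suc (nat (i - s - 1))"
        "nat (i - (s - 1)) = Suc (Suc (nat (i - s - 1)))" by linarith+
      with 4 show ?thesis by simp
    qed simp_all
  qed
  then show ?thesis
    using assms by (simp add: split_config_def tm_step_def fun_eq_iff)
qed

lemma tm_step_left_at_left_end:
  assumes "\<delta> p a = (a', MoveL, q)"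
  shows "tm_step \<delta> (split_config b s p [] (a # R)) = split_config b (s - 1) q [] (b # a' # R)"
  using tm_step_left[of \<delta> p a a' q b s b "[]" R, OF assms] by (simp add: split_config_blank_left)

lemma translate_split_config:
  "translate r (split_config b s p L R) = split_config b (s + r) p L R"
  by (auto simp: translate_def split_config_def fun_eq_iff algebra_simps)

lemma displayed_config_eq_split_config:
  "displayed_config b u p a v = split_config b (int (length u)) p (rev u) (a # v)"
proof -
  have "(if 0 \<le> i \<and> i < int (length (u @ a # v)) then (u @ a # v) ! nat i else b) =
        (if i < int (length u) then nth_default b (rev u) (nat (int (length u) - 1 - i))
         else nth_default b (a # v) (nat (i - int (length u))))" for i
  proof (cases "0 \<le> i")
    case True
    then obtain n where "i = int n" by (metis nonneg_int_cases)
    moreover have "nat (int (length u) - 1 - int n) = length u - 1 - n"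
      "nat (int n - int (length u)) = n - length u"
      by linarith+
    ultimately show ?thesis
      by (auto simp: nth_default_def nth_append rev_nth simp del: nth_Cons' nth_Cons_Suc)
  qed (auto simp: nth_default_def)
  then show ?thesis
    by (simp add: displayed_config_def split_config_def Let_def fun_eq_iff)
qed

text \<open>
  Without blanks in the lists, their lengths are visible on the tape as the distance from the
  head to the first blank, so nothing is lost in passing to the tape.
\<close>
lemma split_config_inject:
  fixes b :: 's
  assumes eq: "split_config b s p L R = split_config b s' p' L' R'"
    and "b \<notin> set L" "b \<notin> set R" "b \<notin> set L'" "b \<notin> set R'"
  shows "p = p' \<and> L = L' \<and> R = R'"
proof -
  have no_blank: "xs = ys"
    if "nth_default b xs = nth_default b ys" "b \<notin> set xs" "b \<notin> set ys" for xs ys :: "'s list"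
  proof -
    have "strip_while ((=) b) zs = zs" if "b \<notin> set zs" for zs
      using that by (cases zs rule: rev_cases) auto
    then show ?thesis using that by (metis nth_default_eq_iff)
  qed
  from eq have s: "s' = s" and p: "p = p'"
    by (simp_all add: split_config_def)
  have tape: "(if i < s then nth_default b L (nat (s - 1 - i))
                     else nth_default b R (nat (i - s))) =
                   (if i < s then nth_default b L' (nat (s - 1 - i))
                     else nth_default b R' (nat (i - s)))" for i
    using fun_cong[OF arg_cong[OF eq, of tape], of i] unfolding s
    by (simp only: split_config_def config.sel)
  have "nth_default b L n = nth_default b L' n" for n
    using tape[of "s - 1 - int n"] by simp
  moreover have "nth_default b R n = nth_default b R' n" for n
    using tape[of "s + int n"] by simp
  ultimately show ?thesis
    using no_blank assms p by (simp add: fun_eq_iff)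
qed

section \<open>Ternary words\<close>

text \<open>
  The blank counts as \<open>0\<close>: then a blank in front of a word does not change its value, which is
  what happens when the head has run over the left end of the word.
\<close>
fun digit :: "m1_symbol \<Rightarrow> nat" where
  "digit Blank = 0"
| "digit D0 = 0"
| "digit D1 = 1"
| "digit D2 = 2"

text \<open>
  Horner's scheme with a starting value: \<open>n\<close> is the value of the digits in front of the word.
\<close>
definition base3_from :: "nat \<Rightarrow> m1_symbol list \<Rightarrow> nat" where
  "base3_from n w = foldl (\<lambda>m a. 3 * m + digit a) n w"

abbreviation base3 :: "m1_symbol list \<Rightarrow> nat" where
  "base3 \<equiv> base3_from 0"

lemma base3_from_simps [simp]:
  "base3_from n [] = n"
  "base3_from n (a # w) = base3_from (3 * n + digit a) w"
  "base3_from n (v @ w) = base3_from (base3_from n v) w"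
  by (simp_all add: base3_from_def)

lemma base3_eq_0D: "base3 w = 0 \<Longrightarrow> Blank \<notin> set w \<Longrightarrow> w = replicate (length w) D0"
proof (induction w rule: rev_induct)
  case (snoc a w)
  then have "a = D0" "w = replicate (length w) D0"
    by (cases a; simp)+
  then show ?case
    using replicate_append_same[of "length w" D0] by simp
qed simp

lemma base3_eq_1D:
  assumes "base3 w = 1" "Blank \<notin> set w"
  shows "\<exists>n. w = replicate n D0 @ [D1]"
proof (cases w rule: rev_cases)
  case (snoc v a)
  with assms have "base3 v = 0" "a = D1"
    by (cases a; simp; presburger)+
  with snoc assms base3_eq_0D[of v] show ?thesis by auto
qed (use assms in simp)

lemma base3_from_digits:
  assumes "\<forall>i<k. d i \<in> {0, 1, 2}"
  shows "base3_from n (map (\<lambda>i. digit_symbol (d i)) (rev [0..<k])) =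
         n * 3 ^ k + (\<Sum>i<k. d i * 3 ^ i)"
  using assms
proof (induction k arbitrary: n)
  case (Suc k)
  have "digit (digit_symbol (d k)) = d k"
    using Suc.prems by (auto simp: digit_symbol_def)
  with Suc show ?case by (simp add: algebra_simps)
qed simp

lemma ex_base3_digits:
  assumes "x > 0"
  shows "\<exists>k d. base3_digits x k d"
  using assms
proof (induction x rule: less_induct)
  case (less x)
  show ?case
  proof (cases "x < 3")
    case True
    with less.prems have "base3_digits x 0 (\<lambda>_. x)"
      by (auto simp: base3_digits_def)
    then show ?thesis by blast
  next
    case False
    then obtain k d where d: "base3_digits (x div 3) k d"
      using less.IH[of "x div 3"] by (auto simp: div_greater_zero_iff)
    define d' where "d' = case_nat (x mod 3) d"
    have "(\<Sum>i=0..Suc k. d' i * 3 ^ i) = x mod 3 + 3 * (\<Sum>i=0..k. d i * 3 ^ i)"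
      by (simp add: d'_def sum.atLeast0_atMost_Suc_shift sum_distrib_left mult.left_commute
          del: sum.cl_ivl_Suc)
    also have "\<dots> = x mod 3 + 3 * (x div 3)" using d by (simp add: base3_digits_def)
    also have "\<dots> = x" by simp
    finally have "base3_digits x (Suc k) d'"
      using d by (auto simp: base3_digits_def d'_def split: nat.split)
    then show ?thesis by blast
  qed
qed

section \<open>One sweep of the machine\<close>

abbreviation m1_config ::
    "int \<Rightarrow> m1_state \<Rightarrow> m1_symbol list \<Rightarrow> m1_symbol list \<Rightarrow> (m1_state, m1_symbol) config" where
  "m1_config \<equiv> split_config Blank"

text \<open>The remainder that a dividing state holds; state \<open>QC\<close> does not divide.\<close>
fun carry :: "m1_state \<Rightarrow> nat" where
  "carry QA = 0"
| "carry QB = 1"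
| "carry QC = 0"

lemma M1_divides:
  assumes "p \<noteq> QC" "a \<noteq> Blank"
  obtains a' q where "M1 p a = (a', MoveR, q)" "q \<noteq> QC" "a' \<noteq> Blank"
    "3 * carry p + digit a = 2 * digit a' + carry q"
  using assms by (cases p; cases a) auto

text \<open>
  With quotient \<open>u\<close> and carry \<open>c\<close>, the part already read has value \<open>2 * u + c\<close>. Continuing
  Horner's scheme from there over the unread digits gives the number under division, and the
  identity in \<open>M1_divides\<close> says that a step does not change it.
\<close>
lemma divide_step:
  assumes "p \<noteq> QC" "a \<noteq> Blank"
  obtains a' q where "tm_step M1 (m1_config s p L (a # R)) = m1_config (s + 1) q (a' # L) R"
    "q \<noteq> QC" "a' \<noteq> Blank"
    "base3_from (2 * base3 (rev (a' # L)) + carry q) R =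
     base3_from (2 * base3 (rev L) + carry p) (a # R)"
proof -
  obtain a' q where step: "M1 p a = (a', MoveR, q)" "q \<noteq> QC" "a' \<noteq> Blank"
    and c: "3 * carry p + digit a = 2 * digit a' + carry q"
    using M1_divides[OF assms] .
  have "2 * (3 * base3 (rev L) + digit a') + carry q = 3 * (2 * base3 (rev L) + carry p) + digit a"
    using c by (simp add: algebra_simps)
  then have "base3_from (2 * base3 (rev (a' # L)) + carry q) R =
      base3_from (2 * base3 (rev L) + carry p) (a # R)"
    by (simp only: rev.simps base3_from_simps)
  with step show ?thesis by (intro that[OF tm_step_right])
qed

text \<open>
  At the right end the quotient is complete. An odd number \<open>2 * u + 1\<close> is mapped by \<open>T\<close> to
  \<open>3 * u + 2\<close>, which is the quotient with a digit \<open>2\<close> appended.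
\<close>
lemma turn:
  assumes "p \<noteq> QC" "L \<noteq> []" "Blank \<notin> set L"
  obtains L' R' where "tm_step M1 (m1_config s p L []) = m1_config (s - 1) QC L' R'"
    "Blank \<notin> set L'" "Blank \<notin> set R'" "R' \<noteq> []"
    "base3 (rev L' @ R') = T (2 * base3 (rev L) + carry p)"
proof -
  obtain l L' where L: "L = l # L'" using assms(2) by (cases L) auto
  have blank: "m1_config s p L [] = m1_config s p (l # L') [Blank]"
    using split_config_blank_right[of Blank s p L "[]"] L by simp
  show ?thesis
  proof (cases p)
    case QA
    have "tm_step M1 (m1_config s p L []) = m1_config (s - 1) QC L' ([l] @ [Blank])"
      unfolding blank using tm_step_left[of M1 p Blank Blank QC] QA by simp
    then have "tm_step M1 (m1_config s p L []) = m1_config (s - 1) QC L' [l]"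
      unfolding split_config_blank_right .
    then show ?thesis
      using that[of L' "[l]"] assms L QA by (simp add: T_def)
  next
    case QB
    have "tm_step M1 (m1_config s p L []) = m1_config (s - 1) QC L' [l, D2]"
      unfolding blank using tm_step_left[of M1 p Blank D2 QC] QB by simp
    then show ?thesis
      using that[of L' "[l, D2]"] assms L QB by (simp add: T_def)
  qed (use assms in simp)
qed

lemma rewind_step:
  assumes "r \<noteq> Blank"
  shows "tm_step M1 (m1_config s QC (l # L) (r # R)) = m1_config (s - 1) QC L (l # r # R)"
    and "tm_step M1 (m1_config s QC [] (r # R)) = m1_config (s - 1) QC [] (Blank # r # R)"
  using assms by (cases r; simp add: tm_step_left tm_step_left_at_left_end)+

lemma restart_step:
  "tm_step M1 (m1_config s QC [] (Blank # R)) = m1_config (s + 1) QA [] R"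
  by (simp add: tm_step_right split_config_blank_left)

definition leads_to ::
    "(m1_state, m1_symbol) config \<Rightarrow> (m1_state, m1_symbol) config \<Rightarrow> bool" where
  "leads_to c c' \<longleftrightarrow> (\<exists>t. (tm_step M1 ^^ t) c = c')"

lemma leads_to_refl: "leads_to c c"
  unfolding leads_to_def by (rule exI[of _ 0]) simp

lemma leads_to_step: "leads_to c (tm_step M1 c)"
  unfolding leads_to_def by (rule exI[of _ 1]) simp

lemma leads_to_trans:
  assumes "leads_to c c'" "leads_to c' c''"
  shows "leads_to c c''"
proof -
  obtain t t' where "(tm_step M1 ^^ t) c = c'" "(tm_step M1 ^^ t') c' = c''"
    using assms unfolding leads_to_def by blast
  then have "(tm_step M1 ^^ (t' + t)) c = c''" by (simp add: funpow_add)
  then show ?thesis unfolding leads_to_def by blast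
qed

lemma leads_to_Cons: "leads_to (tm_step M1 c) c' \<Longrightarrow> leads_to c c'"
  using leads_to_step leads_to_trans by blast

lemma divide:
  assumes "p \<noteq> QC" "Blank \<notin> set L" "Blank \<notin> set R"
  shows "\<exists>s' q L'. leads_to (m1_config s p L R) (m1_config s' q L' []) \<and> q \<noteq> QC \<and>
           Blank \<notin> set L' \<and> length L' = length L + length R \<and>
           2 * base3 (rev L') + carry q = base3_from (2 * base3 (rev L) + carry p) R"
  using assms
proof (induction R arbitrary: s p L)
  case Nil
  then show ?case using leads_to_refl by (intro exI[of _ s] exI[of _ p] exI[of _ L]) auto
next
  case (Cons a R)
  have "a \<noteq> Blank" using Cons.prems by auto
  from divide_step[OF Cons.prems(1) this, of s L R] obtain a' q where step:
    "tm_step M1 (m1_config s p L (a # R)) = m1_config (s + 1) q (a' # L) R"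
    "q \<noteq> QC" "a' \<noteq> Blank"
    "base3_from (2 * base3 (rev (a' # L)) + carry q) R =
     base3_from (2 * base3 (rev L) + carry p) (a # R)" .
  have "Blank \<notin> set (a' # L)" "Blank \<notin> set R"
    using step(3) Cons.prems by auto
  from Cons.IH[OF step(2) this, of "s + 1"] obtain s' q' L' where *:
    "leads_to (m1_config (s + 1) q (a' # L) R) (m1_config s' q' L' [])"
    "q' \<noteq> QC" "Blank \<notin> set L'" "length L' = length (a' # L) + length R"
    "2 * base3 (rev L') + carry q' = base3_from (2 * base3 (rev (a' # L)) + carry q) R"
    by blast
  have "leads_to (m1_config s p L (a # R)) (m1_config s' q' L' [])"
    using leads_to_Cons *(1) step(1) by simp
  moreover have "length L' = length L + length (a # R)"
    using *(4) by simp
  moreover have "2 * base3 (rev L') + carry q' = base3_from (2 * base3 (rev L) + carry p) (a # R)"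
    using *(5) step(4) by (rule trans)
  ultimately show ?case using *(2,3) by blast
qed

lemma rewind:
  assumes "R \<noteq> []" "Blank \<notin> set L" "Blank \<notin> set R"
  shows "\<exists>s'. leads_to (m1_config s QC L R) (m1_config s' QA [] (rev L @ R))"
  using assms
proof (induction L arbitrary: s R)
  case Nil
  then obtain r R' where R: "R = r # R'" "r \<noteq> Blank" by (cases R) auto
  have "leads_to (m1_config s QC [] R) (m1_config (s - 1 + 1) QA [] R)"
    using leads_to_Cons leads_to_step rewind_step(2)[OF R(2)] restart_step R(1) by metis
  then show ?case by auto
next
  case (Cons l L)
  then obtain r R' where R: "R = r # R'" "r \<noteq> Blank" by (cases R) auto
  obtain s' where "leads_to (m1_config (s - 1) QC L (l # R)) (m1_config s' QA [] (rev L @ l # R))"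
    using Cons.IH[of "l # R" "s - 1"] Cons.prems by auto
  then have "leads_to (m1_config s QC (l # L) R) (m1_config s' QA [] (rev L @ l # R))"
    using leads_to_Cons rewind_step(1)[OF R(2)] R(1) by metis
  then show ?case by auto
qed

lemma sweep:
  assumes "R \<noteq> []" "Blank \<notin> set R"
  shows "\<exists>s' R'. leads_to (m1_config s QA [] R) (m1_config s' QA [] R') \<and>
           R' \<noteq> [] \<and> Blank \<notin> set R' \<and> base3 R' = T (base3 R)"
proof -
  have "\<exists>s' q L'. leads_to (m1_config s QA [] R) (m1_config s' q L' []) \<and> q \<noteq> QC \<and>
          Blank \<notin> set L' \<and> length L' = length R \<and> 2 * base3 (rev L') + carry q = base3 R"
    using divide[of QA "[]" R s] assms by simp
  then obtain s1 q L where 1: "leads_to (m1_config s QA [] R) (m1_config s1 q L [])"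
    "q \<noteq> QC" "Blank \<notin> set L" "length L = length R" "2 * base3 (rev L) + carry q = base3 R"
    by blast
  have "L \<noteq> []" using 1(4) assms(1) by auto
  then obtain L' R' where 2: "tm_step M1 (m1_config s1 q L []) = m1_config (s1 - 1) QC L' R'"
    "Blank \<notin> set L'" "Blank \<notin> set R'" "R' \<noteq> []" "base3 (rev L' @ R') = T (base3 R)"
    using turn[of q L s1] 1 by metis
  obtain s2 where 3: "leads_to (m1_config (s1 - 1) QC L' R') (m1_config s2 QA [] (rev L' @ R'))"
    using rewind[OF 2(4,2,3)] by blast
  have "leads_to (m1_config s QA [] R) (m1_config s2 QA [] (rev L' @ R'))"
    using 1(1) 2(1) 3 leads_to_Cons leads_to_trans by metis
  then show ?thesis
    using 2 by (intro exI[of _ s2] exI[of _ "rev L' @ R'"]) auto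
qed

lemma sweeps:
  assumes "R \<noteq> []" "Blank \<notin> set R"
  shows "\<exists>s' R'. leads_to (m1_config s QA [] R) (m1_config s' QA [] R') \<and>
           R' \<noteq> [] \<and> Blank \<notin> set R' \<and> base3 R' = (T ^^ j) (base3 R)"
proof (induction j)
  case 0
  then show ?case
    using assms leads_to_refl by (intro exI[of _ s] exI[of _ R]) auto
next
  case (Suc j)
  then obtain s1 R1 where 1: "leads_to (m1_config s QA [] R) (m1_config s1 QA [] R1)"
    "R1 \<noteq> []" "Blank \<notin> set R1" "base3 R1 = (T ^^ j) (base3 R)"
    by blast
  obtain s2 R2 where "leads_to (m1_config s1 QA [] R1) (m1_config s2 QA [] R2)"
    "R2 \<noteq> []" "Blank \<notin> set R2" "base3 R2 = T (base3 R1)"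
    using sweep[OF 1(2,3)] by blast
  then show ?case using leads_to_trans 1 by (metis funpow.simps(2) comp_apply)
qed

lemma skip_zeros:
  "\<exists>s'. leads_to (m1_config s QA L (replicate n D0 @ R)) (m1_config s' QA (replicate n D0 @ L) R)"
proof (induction n arbitrary: s L)
  case 0
  then show ?case using leads_to_refl by auto
next
  case (Suc n)
  have "tm_step M1 (m1_config s QA L (replicate (Suc n) D0 @ R)) =
        m1_config (s + 1) QA (D0 # L) (replicate n D0 @ R)"
    by (simp add: tm_step_right)
  moreover obtain s' where "leads_to (m1_config (s + 1) QA (D0 # L) (replicate n D0 @ R))
      (m1_config s' QA (replicate n D0 @ D0 # L) R)"
    using Suc by blast
  moreover have "replicate n D0 @ D0 # L = replicate (Suc n) D0 @ L"
    by (simp add: replicate_app_Cons_same)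
  ultimately show ?case using leads_to_Cons by metis
qed

section \<open>The number represented by a configuration\<close>

text \<open>
  This is the invariant of the run. In state \<open>QC\<close> the head may have run over the left end of the
  word, onto a blank, hence the third case. The word is nonempty in all cases, so that the turn
  at its right end puts the head on a digit.
\<close>
definition represents :: "(m1_state, m1_symbol) config \<Rightarrow> nat \<Rightarrow> bool" where
  "represents c y \<longleftrightarrow>
     (\<exists>s p L R. c = m1_config s p L R \<and> p \<noteq> QC \<and> L @ R \<noteq> [] \<and>
        Blank \<notin> set L \<and> Blank \<notin> set R \<and> y = base3_from (2 * base3 (rev L) + carry p) R) \<or>
     (\<exists>s L R. c = m1_config s QC L R \<and> R \<noteq> [] \<and>
        Blank \<notin> set L \<and> Blank \<notin> set R \<and> y = base3 (rev L @ R)) \<or>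
     (\<exists>s R. c = m1_config s QC [] (Blank # R) \<and> R \<noteq> [] \<and> Blank \<notin> set R \<and> y = base3 R)"

lemma represents_dividing:
  assumes "p \<noteq> QC" "L @ R \<noteq> []" "Blank \<notin> set L" "Blank \<notin> set R"
    "y = base3_from (2 * base3 (rev L) + carry p) R"
  shows "represents (m1_config s p L R) y"
  unfolding represents_def using assms by blast

lemma represents_rewinding:
  assumes "R \<noteq> []" "Blank \<notin> set L" "Blank \<notin> set R" "y = base3 (rev L @ R)"
  shows "represents (m1_config s QC L R) y"
  unfolding represents_def using assms by blast

lemma represents_at_left_end:
  assumes "R \<noteq> []" "Blank \<notin> set R"
  shows "represents (m1_config s QC [] (Blank # R)) (base3 R)"
  unfolding represents_def using assms by blast

lemma represents_step:
  assumes "represents c y"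
  shows "represents (tm_step M1 c) y \<or> represents (tm_step M1 c) (T y)"
proof -
  consider (dividing) s p L R where "c = m1_config s p L R" "p \<noteq> QC" "L @ R \<noteq> []"
      "Blank \<notin> set L" "Blank \<notin> set R" "y = base3_from (2 * base3 (rev L) + carry p) R"
    | (rewinding) s L R where "c = m1_config s QC L R" "R \<noteq> []"
      "Blank \<notin> set L" "Blank \<notin> set R" "y = base3 (rev L @ R)"
    | (left_end) s R where "c = m1_config s QC [] (Blank # R)" "R \<noteq> []" "Blank \<notin> set R"
      "y = base3 R"
    using assms unfolding represents_def by blast
  then show ?thesis
  proof cases
    case dividing
    show ?thesis
    proof (cases R)
      case Nil
      then obtain L' R' where "tm_step M1 c = m1_config (s - 1) QC L' R'"
        "Blank \<notin> set L'" "Blank \<notin> set R'" "R' \<noteq> []" "base3 (rev L' @ R') = T y"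
        using turn[of p L s] dividing by auto
      then show ?thesis using represents_rewinding by metis
    next
      case (Cons a R')
      then have "a \<noteq> Blank" using dividing by auto
      from divide_step[OF dividing(2) this, of s L R']
      obtain a' q where "tm_step M1 c = m1_config (s + 1) q (a' # L) R'"
        "q \<noteq> QC" "a' \<noteq> Blank" "y = base3_from (2 * base3 (rev (a' # L)) + carry q) R'"
        using dividing(1,6) Cons by metis
      then show ?thesis
        using represents_dividing[of q "a' # L" R' y "s + 1"] dividing Cons by auto
    qed
  next
    case rewinding
    then obtain r R' where R: "R = r # R'" "r \<noteq> Blank" by (cases R) auto
    show ?thesis
    proof (cases L)
      case Nil
      then have "tm_step M1 c = m1_config (s - 1) QC [] (Blank # R)" "y = base3 R"
        using rewinding R rewind_step(2) by auto
      then show ?thesis using represents_at_left_end rewinding by metis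
    next
      case (Cons l L')
      then have "tm_step M1 c = m1_config (s - 1) QC L' (l # R)"
        using rewinding R rewind_step(1) by auto
      then show ?thesis
        using represents_rewinding[of "l # R" L' y "s - 1"] rewinding Cons by auto
    qed
  next
    case left_end
    then have "tm_step M1 c = m1_config (s + 1) QA [] R" by (simp add: restart_step)
    then show ?thesis using represents_dividing[of QA "[]" R y] left_end by auto
  qed
qed

lemma represents_iterate:
  assumes "represents c x"
  shows "\<exists>j. represents ((tm_step M1 ^^ t) c) ((T ^^ j) x)"
proof (induction t)
  case 0
  then show ?case using assms by (intro exI[of _ 0]) simp
next
  case (Suc t)
  then obtain j where "represents ((tm_step M1 ^^ t) c) ((T ^^ j) x)" by blast
  from represents_step[OF this] show ?case
    by (metis funpow.simps(2) comp_apply)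
qed

lemma represents_final:
  assumes "represents (m1_config s QA (replicate n D0) [D1]) y"
  shows "y = 1"
proof -
  obtain s' p L R where *: "m1_config s QA (replicate n D0) [D1] = m1_config s' p L R"
    "Blank \<notin> set L" "Blank \<notin> set R" "y = base3_from (2 * base3 (rev L) + carry p) R"
    using assms unfolding represents_def by (auto simp: split_config_def)
  then have "p = QA" "L = replicate n D0" "R = [D1]"
    using split_config_inject[OF *(1)] by auto
  moreover have "base3 (replicate n D0) = 0" by (induction n) auto
  ultimately show ?thesis using * by simp
qed

section \<open>The equivalence\<close>

lemma input_config_eq:
  assumes "base3_digits x k d"
  obtains R where "input_config k d = m1_config 0 QA [] R" "R \<noteq> []" "Blank \<notin> set R" "base3 R = x"
proof -
  define R where "R = map (\<lambda>i. digit_symbol (d i)) (rev [0..<Suc k])"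
  have "input_config k d = m1_config 0 QA [] R"
    by (simp add: R_def input_config_def displayed_config_eq_split_config)
  moreover have "Blank \<notin> set R" "R \<noteq> []" by (auto simp: R_def digit_symbol_def)
  moreover have "base3 R = (\<Sum>i<Suc k. d i * 3 ^ i)"
    using assms base3_from_digits[of "Suc k" d 0] by (simp add: R_def base3_digits_def)
  then have "base3 R = x"
    using assms by (simp add: base3_digits_def atLeast0AtMost lessThan_Suc_atMost)
  ultimately show ?thesis using that by blast
qed

lemma collatz_conjecture_iff:
  "collatz_conjecture \<longleftrightarrow> (\<forall>x>0. \<exists>j. (T ^^ j) x = 1)"
proof
  assume collatz: collatz_conjecture
  show "\<forall>x>0. \<exists>j. (T ^^ j) x = 1"
  proof (intro allI impI)
    fix x :: nat assume "x > 0"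
    then obtain j where "(T ^^ j) x \<in> {1, 2}"
      using collatz unfolding collatz_conjecture_def by blast
    then have "(T ^^ j) x = 1 \<or> (T ^^ Suc j) x = 1" by (auto simp: T_def)
    then show "\<exists>j. (T ^^ j) x = 1" by blast
  qed
qed (auto simp: collatz_conjecture_def)

lemma reaches_final_iff:
  assumes "base3_digits x k d"
  shows "(\<exists>n. reaches M1 (input_config k d)
            (displayed_config Blank (replicate n D0) QA D1 [])) \<longleftrightarrow> (\<exists>j. (T ^^ j) x = 1)"
proof -
  obtain R where R: "input_config k d = m1_config 0 QA [] R" "R \<noteq> []" "Blank \<notin> set R"
    "base3 R = x"
    using input_config_eq[OF assms] .
  have final: "displayed_config Blank (replicate n D0) QA D1 [] =
      m1_config (int n) QA (replicate n D0) [D1]" for n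
    by (simp add: displayed_config_eq_split_config)
  show ?thesis
  proof
    assume "\<exists>n. reaches M1 (input_config k d) (displayed_config Blank (replicate n D0) QA D1 [])"
    then obtain n t r where "m1_config (int n) QA (replicate n D0) [D1] =
        translate r ((tm_step M1 ^^ t) (m1_config 0 QA [] R))" (is "_ = translate r ?c")
      unfolding reaches_def same_config_def final R(1) by blast
    then have "translate (- r) (m1_config (int n) QA (replicate n D0) [D1]) =
        translate (- r) (translate r ?c)"
      by simp
    then have c: "?c = m1_config (int n - r) QA (replicate n D0) [D1]"
      by (simp add: translate_split_config) (simp add: translate_def)
    have "represents (m1_config 0 QA [] R) x"
      using R by (intro represents_dividing) auto
    then obtain j where "represents ?c ((T ^^ j) x)"
      using represents_iterate by blast
    then show "\<exists>j. (T ^^ j) x = 1"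
      unfolding c using represents_final by blast
  next
    assume "\<exists>j. (T ^^ j) x = 1"
    then obtain s R' where 1: "leads_to (m1_config 0 QA [] R) (m1_config s QA [] R')"
      "Blank \<notin> set R'" "base3 R' = 1"
      using sweeps[OF R(2,3)] R(4) by metis
    then obtain n where n: "R' = replicate n D0 @ [D1]" using base3_eq_1D by blast
    obtain s' where "leads_to (m1_config s QA [] R') (m1_config s' QA (replicate n D0) [D1])"
      using skip_zeros[of s "[]" n "[D1]"] n by auto
    with 1(1) have "leads_to (input_config k d) (m1_config s' QA (replicate n D0) [D1])"
      unfolding R(1) by (rule leads_to_trans)
    then obtain t where "(tm_step M1 ^^ t) (input_config k d) =
        m1_config s' QA (replicate n D0) [D1]"
      unfolding leads_to_def by blast
    then have "displayed_config Blank (replicate n D0) QA D1 [] =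
        translate (int n - s') ((tm_step M1 ^^ t) (input_config k d))"
      by (simp add: final translate_split_config)
    then show "\<exists>n. reaches M1 (input_config k d)
        (displayed_config Blank (replicate n D0) QA D1 [])"
      unfolding reaches_def same_config_def by blast
  qed
qed

theorem theorem4p1:
  "collatz_conjecture \<longleftrightarrow>
     (\<forall>x k d. x > 0 \<and> base3_digits x k d \<longrightarrow>
        (\<exists>n. reaches M1 (input_config k d)
               (displayed_config Blank (replicate n D0) QA D1 [])))"
  unfolding collatz_conjecture_iff using reaches_final_iff ex_base3_digits by metis

end
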